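(* Let $(E,\tau)$ be a real topological linear space, $\psi:E\to\mathbb{R}$ a seminorm, $K, A\subseteq E$ nontrivial cones with normlike-bases $B_K$ and $B_A$ (with respect to $\psi$), and let $K$ be $\tau$-solid. Define $S_{-K}:=\mathrm{conv}(-B_K)$ and $S_A^0:=\mathrm{conv}(B_A\cup\{0\})$. If $S_{-K}$ is $\tau$-solid and $S_A^0\cap\mathrm{int}_\tau\,S_{-K}=\emptyset$, then there exists $(x^*,\alpha)\in K_\tau^{a\circ}$ such that $$x^*(a)+\alpha\psi(a)\ \geq\ 0\ \geq\ x^*(k)+\alpha\psi(k)\quad\text{for all } a\in A\text{ and }k\in -K,$$ $$x^*(a)+\alpha\psi(a)\ \geq\ 0\ >\ x^*(k)+\alpha\psi(k)\quad\text{for all } a\in A\text{ and }k\in \mathrm{int}_\tau(-K).$$ In particular, $A\cap\mathrm{int}_\tau(-K)=\emptyset$ and $0\notin\mathrm{int}_\tau\,S_{-K}$.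
   Context: $E\neq\{0\}$; $E'$ is the algebraic dual and $E^*=(E,\tau)^*$ the topological dual; $\mathbb{R}_+=[0,\infty)$. A set $K\subseteq E$ is a cone if $0\in K=\mathbb{R}_+\cdot K$ (not necessarily convex); it is nontrivial if $\{0\}\neq K\neq E$; $\ell(K):=K\cap(-K)$ (same notation for cones in $E'$). A seminorm is a sublinear symmetric function $\psi:E\to\mathbb{R}$ (not assumed $\tau$-continuous). A nontrivial cone $K$ has a normlike-base (w.r.t. $\psi$) if $\psi(x)>0$ for all $x\in K\setminus\{0\}$; the normlike-base is then $B_K:=\{x\in K\mid \psi(x)=1\}$. All normlike-bases are taken with respect to the same fixed seminorm $\psi$. A set $\Omega$ is $\tau$-solid if its $\tau$-interior $\mathrm{int}_\tau\,\Omega$ is nonempty. For $\Omega\subseteq E$, $\mathrm{icor}\,\Omega:=\{x\in\Omega\mid \forall v\in \mathrm{aff}(\Omega-\Omega)\ \exists\varepsilon>0:\ x+[0,\varepsilon]\cdot v\subseteq\Omega\}$, where $\mathrm{aff}$ is the affine hull; $\mathrm{conv}$ is the convex hull. $K^+:=\{y'\in E'\mid \forall k\in K:\ y'(k)\geq 0\}$, $K^{a\circ}:=\{(x',\alpha)\in (K^+\setminus\ell(K^+))\times\mathbb{R}_+\mid \forall y\in\mathrm{icor}\,K:\ x'(y)-\alpha\psi(y)>0\}$, and $K_\tau^{a\circ}:=K^{a\circ}\cap(E^*\times\mathbb{R})$. *)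

theory Defs
  imports "HOL-Analysis.Analysis"
begin

(* Joint continuity of scalar multiplication is stated with filters, in the style of
   topological_monoid_add; no separation axiom is assumed. *)
class topological_real_vector = real_vector + topological_ab_group_add +
  assumes tendsto_scaleR_Pair:
    "LIM p (nhds c \<times>\<^sub>F nhds x). fst p *\<^sub>R snd p :> nhds (c *\<^sub>R x)"

definition algebraic_dual :: "('a::real_vector \<Rightarrow> real) set" where
  "algebraic_dual = {x'. linear x'}"

definition topological_dual :: "('a::topological_real_vector \<Rightarrow> real) set" where
  "topological_dual = {x'. linear x' \<and> continuous_on UNIV x'}"

(* Unlike the library's cone, this excludes the empty set. *)
definition is_cone :: "'a::real_vector set \<Rightarrow> bool" where
  "is_cone K \<longleftrightarrow> 0 \<in> K \<and> K = {t *\<^sub>R x |t x. 0 \<le> t \<and> x \<in> K}"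

definition nontrivial_cone :: "'a::real_vector set \<Rightarrow> bool" where
  "nontrivial_cone K \<longleftrightarrow> is_cone K \<and> K \<noteq> {0} \<and> K \<noteq> UNIV"

(* The pointwise negation of K is written uminus ` K throughout, as - K is the set complement.
   The function is also used for cones of functionals, negated pointwise. *)
definition lineality :: "'a::uminus set \<Rightarrow> 'a set" where
  "lineality K = K \<inter> uminus ` K"

definition is_seminorm :: "('a::real_vector \<Rightarrow> real) \<Rightarrow> bool" where
  "is_seminorm \<psi> \<longleftrightarrow>
     (\<forall>x y. \<psi> (x + y) \<le> \<psi> x + \<psi> y) \<and>
     (\<forall>t x. 0 \<le> t \<longrightarrow> \<psi> (t *\<^sub>R x) = t * \<psi> x) \<and>
     (\<forall>x. \<psi> (- x) = \<psi> x)"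

definition has_normlike_base :: "('a::real_vector \<Rightarrow> real) \<Rightarrow> 'a set \<Rightarrow> bool" where
  "has_normlike_base \<psi> K \<longleftrightarrow> (\<forall>x \<in> K - {0}. 0 < \<psi> x)"

definition normlike_base :: "('a::real_vector \<Rightarrow> real) \<Rightarrow> 'a set \<Rightarrow> 'a set" where
  "normlike_base \<psi> K = {x \<in> K. \<psi> x = 1}"

definition solid :: "'a::topological_space set \<Rightarrow> bool" where
  "solid S \<longleftrightarrow> interior S \<noteq> {}"

definition icor :: "'a::real_vector set \<Rightarrow> 'a set" where
  "icor S = {x \<in> S. \<forall>v \<in> affine hull {s - s' |s s'. s \<in> S \<and> s' \<in> S}.
     \<exists>\<epsilon>>0. \<forall>t \<in> {0..\<epsilon>}. x + t *\<^sub>R v \<in> S}"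

definition dual_cone :: "'a::real_vector set \<Rightarrow> ('a \<Rightarrow> real) set" where
  "dual_cone K = {y' \<in> algebraic_dual. \<forall>k \<in> K. 0 \<le> y' k}"

definition aug_dual_cone ::
  "('a::real_vector \<Rightarrow> real) \<Rightarrow> 'a set \<Rightarrow> (('a \<Rightarrow> real) \<times> real) set" where
  "aug_dual_cone \<psi> K =
     {(x', \<alpha>) \<in> (dual_cone K - lineality (dual_cone K)) \<times> {0..}.
        \<forall>y \<in> icor K. x' y - \<alpha> * \<psi> y > 0}"

definition top_aug_dual_cone ::
  "('a::topological_real_vector \<Rightarrow> real) \<Rightarrow> 'a set \<Rightarrow> (('a \<Rightarrow> real) \<times> real) set" where
  "top_aug_dual_cone \<psi> K = aug_dual_cone \<psi> K \<inter> (topological_dual \<times> UNIV)"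

definition S_neg :: "('a::real_vector \<Rightarrow> real) \<Rightarrow> 'a set \<Rightarrow> 'a set" where
  "S_neg \<psi> K = convex hull (uminus ` normlike_base \<psi> K)"

definition S_zero :: "('a::real_vector \<Rightarrow> real) \<Rightarrow> 'a set \<Rightarrow> 'a set" where
  "S_zero \<psi> A = convex hull (normlike_base \<psi> A \<union> {0})"

end

theory Submission
  imports Defs
begin

text \<open>
  The open convex set \<open>interior (S_neg \<psi> K)\<close> and the convex set \<open>S_zero \<psi> A\<close> are disjoint, so a
  continuous linear \<open>x'\<close> satisfies \<open>x' < - \<alpha>\<close> on the former and \<open>- \<alpha> \<le> x'\<close> on the latter; here
  \<open>\<alpha> \<ge> 0\<close> because \<open>0 \<in> S_zero \<psi> A\<close>. As \<open>\<psi> = 1\<close> on the bases, homogeneity turns this into the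
  signs of the sublinear function \<open>f = x' + \<alpha> \<psi>\<close> on \<open>A\<close> and \<open>- K\<close>. Since \<open>\<psi> \<le> 1\<close> on
  \<open>S_neg \<psi> K\<close>, a point \<open>c\<close> of its interior has \<open>f c < 0\<close>, and subadditivity along
  \<open>k = (k - t c) + t c\<close> gives strictness at every \<open>k\<close> from which \<open>- K\<close> extends in the direction \<open>- c\<close>.

  Separation itself rests on the linearity of minimal sublinear functions, which exist by Zorn's lemma.
\<close>

section \<open>Sublinear functions\<close>

definition sublinear :: "('a::real_vector \<Rightarrow> real) \<Rightarrow> bool" where
  "sublinear p \<longleftrightarrow>
     (\<forall>x y. p (x + y) \<le> p x + p y) \<and> (\<forall>t x. 0 \<le> t \<longrightarrow> p (t *\<^sub>R x) = t * p x)"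

lemma sublinear_add: "sublinear p \<Longrightarrow> p (x + y) \<le> p x + p y"
  by (simp add: sublinear_def)

lemma sublinear_scale: "sublinear p \<Longrightarrow> 0 \<le> t \<Longrightarrow> p (t *\<^sub>R x) = t * p x"
  by (simp add: sublinear_def)

lemma sublinear_0: "sublinear p \<Longrightarrow> p 0 = 0"
  using sublinear_scale[of p 0 0] by simp

lemma sublinear_minus: "sublinear p \<Longrightarrow> - p (- x) \<le> p x"
  using sublinear_add[of p x "- x"] sublinear_0[of p] by simp

text \<open>Applying \<open>scale\<close> with factor \<open>inverse t\<close> at
  \<open>t *\<^sub>R x\<close> yields the reverse inequality. One-sided bounds are what infima give
  directly.\<close>

lemma sublinearI:
  assumes add: "\<And>x y. p (x + y) \<le> p x + p y"
    and scale: "\<And>t x. 0 < t \<Longrightarrow> p (t *\<^sub>R x) \<le> t * p x"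
  shows "sublinear p"
proof -
  \<comment> \<open>The factors 2 and 1/2 bound \<open>p 0\<close> by 0 from below and from
    above.\<close>
  have zero: "p 0 = 0"
    using scale[of 2 0] scale[of "1/2" 0] by simp
  have "p (t *\<^sub>R x) = t * p x" if "0 < t" for t x
  proof (rule antisym[OF scale[OF that]])
    have "p (inverse t *\<^sub>R t *\<^sub>R x) \<le> inverse t * p (t *\<^sub>R x)"
      using that by (intro scale) simp
    then show "t * p x \<le> p (t *\<^sub>R x)"
      using that by (simp add: field_simps)
  qed
  then have "p (t *\<^sub>R x) = t * p x" if "0 \<le> t" for t x
    using that zero by (cases "t = 0") auto
  then show ?thesis
    using add by (simp add: sublinear_def)
qed

text \<open>For functions defined as pointwise infima, this and \<open>Inf_le_mult_Inf\<close>
  reduce the two conditions of \<open>sublinearI\<close> to comparisons between members of the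
  sets.\<close>

lemma le_Inf_add_Inf:
  fixes X Y :: "real set"
  assumes "X \<noteq> {}" "Y \<noteq> {}" "\<And>x y. x \<in> X \<Longrightarrow> y \<in> Y \<Longrightarrow> c \<le> x + y"
  shows "c \<le> Inf X + Inf Y"
proof -
  have "c - x \<le> Inf Y" if "x \<in> X" for x
    using assms(2) assms(3)[OF that] by (intro cInf_greatest) (auto simp: algebra_simps)
  then have "c - Inf Y \<le> Inf X"
    using assms(1) by (intro cInf_greatest) (auto simp: algebra_simps)
  then show ?thesis
    by simp
qed

lemma Inf_le_mult_Inf:
  fixes X Y :: "real set"
  assumes "X \<noteq> {}" "bdd_below Y" "0 < t" "\<And>x. x \<in> X \<Longrightarrow> t * x \<in> Y"
  shows "Inf Y \<le> t * Inf X"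
proof -
  have "Inf Y / t \<le> Inf X"
    using assms(1)
  proof (rule cInf_greatest)
    fix x assume "x \<in> X"
    then have "Inf Y \<le> t * x"
      using assms by (intro cInf_lower) auto
    then show "Inf Y / t \<le> x"
      using assms(3) by (simp add: field_simps)
  qed
  then show ?thesis
    using assms(3) by (simp add: field_simps)
qed

text \<open>This supplies the bounds of chains for Zorn's lemma. The infimum is finite because
  \<open>- p (- x) \<le> - q (- x) \<le> q x\<close>, and subadditivity survives because the smaller
  of two comparable members serves both arguments.\<close>

lemma sublinear_Inf_chain:
  fixes p :: "'a::real_vector \<Rightarrow> real"
  assumes "C \<noteq> {}" and sub: "\<And>q. q \<in> C \<Longrightarrow> sublinear q" and le: "\<And>q. q \<in> C \<Longrightarrow> q \<le> p"
    and chain: "\<And>q r. q \<in> C \<Longrightarrow> r \<in> C \<Longrightarrow> q \<le> r \<or> r \<le> q"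
  shows "sublinear (\<lambda>x. INF q\<in>C. q x)" and "\<And>q. q \<in> C \<Longrightarrow> (\<lambda>x. INF q\<in>C. q x) \<le> q"
proof -
  have bdd: "bdd_below ((\<lambda>q. q x) ` C)" for x
  proof (rule bdd_belowI2)
    fix q assume "q \<in> C"
    then show "- p (- x) \<le> q x"
      using sublinear_minus[OF sub, of q x] le_funD[OF le, of q "- x"] by simp
  qed
  show "(\<lambda>x. INF q\<in>C. q x) \<le> q" if "q \<in> C" for q
    using that bdd by (intro le_funI cINF_lower)
  show "sublinear (\<lambda>x. INF q\<in>C. q x)"
  proof (rule sublinearI)
    fix x y
    show "(INF q\<in>C. q (x + y)) \<le> (INF q\<in>C. q x) + (INF q\<in>C. q y)"
    proof (rule le_Inf_add_Inf)
      fix a b assume "a \<in> (\<lambda>q. q x) ` C" "b \<in> (\<lambda>q. q y) ` C"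
      then obtain q r where qr: "q \<in> C" "r \<in> C" "a = q x" "b = r y"
        by auto
      define s where "s = (if q \<le> r then q else r)"
      have s: "s \<in> C" "s \<le> q" "s \<le> r"
        using chain[of q r] qr by (auto simp: s_def)
      have "(INF q\<in>C. q (x + y)) \<le> s (x + y)"
        using s(1) bdd by (intro cINF_lower)
      also have "\<dots> \<le> s x + s y"
        using s(1) by (intro sublinear_add sub)
      also have "\<dots> \<le> a + b"
        using s(2,3) qr by (simp add: add_mono le_funD)
      finally show "(INF q\<in>C. q (x + y)) \<le> a + b" .
    qed (use assms(1) in auto)
  next
    fix t :: real and x assume t: "0 < t"
    show "(INF q\<in>C. q (t *\<^sub>R x)) \<le> t * (INF q\<in>C. q x)"
    proof (rule Inf_le_mult_Inf[OF _ bdd t])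
      fix a assume "a \<in> (\<lambda>q. q x) ` C"
      then show "t * a \<in> (\<lambda>q. q (t *\<^sub>R x)) ` C"
        using t by (force simp: sublinear_scale sub)
    qed (use assms(1) in auto)
  qed
qed

text \<open>If \<open>q\<close> is minimal, then \<open>r = q\<close> and the last bound becomes the
  missing half of additivity.\<close>

lemma sublinear_below_along:
  fixes q :: "'a::real_vector \<Rightarrow> real"
  assumes q: "sublinear q"
  obtains r where "sublinear r" "r \<le> q" "\<And>x. r x \<le> q (x + y) - q y"
proof
  \<comment> \<open>The parameter \<open>t = 0\<close> gives \<open>r \<le> q\<close>, and
    \<open>t = 1\<close> gives the bound along \<open>y\<close>. Subtracting \<open>t * q y\<close>
    keeps all values above \<open>- q (- x)\<close>, so the infimum is finite.\<close>
  define r where "r x = (INF t\<in>{0..}. q (x + t *\<^sub>R y) - t * q y)" for x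
  have bdd: "bdd_below ((\<lambda>t. q (x + t *\<^sub>R y) - t * q y) ` {0..})" for x
  proof (rule bdd_belowI2)
    fix t :: real assume "t \<in> {0..}"
    then show "- q (- x) \<le> q (x + t *\<^sub>R y) - t * q y"
      using sublinear_add[OF q, of "x + t *\<^sub>R y" "- x"] sublinear_scale[OF q, of t y] by simp
  qed
  have r_le: "r x \<le> q (x + t *\<^sub>R y) - t * q y" if "0 \<le> t" for x t
    unfolding r_def using that by (intro cINF_lower bdd) auto
  show "r \<le> q"
    using r_le[of 0] by (simp add: le_fun_def)
  show "r x \<le> q (x + y) - q y" for x
    using r_le[of 1] by simp
  show "sublinear r"
  proof (rule sublinearI)
    fix a b
    show "r (a + b) \<le> r a + r b"
      unfolding r_def[of a] r_def[of b]
    proof (rule le_Inf_add_Inf)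
      fix c d
      assume "c \<in> (\<lambda>t. q (a + t *\<^sub>R y) - t * q y) ` {0..}"
        and "d \<in> (\<lambda>t. q (b + t *\<^sub>R y) - t * q y) ` {0..}"
      then obtain s t where st: "0 \<le> s" "0 \<le> t"
        and c: "c = q (a + s *\<^sub>R y) - s * q y" and d: "d = q (b + t *\<^sub>R y) - t * q y"
        by auto
      have "r (a + b) \<le> q ((a + s *\<^sub>R y) + (b + t *\<^sub>R y)) - (s + t) * q y"
        using r_le[of "s + t" "a + b"] st by (simp add: algebra_simps)
      also have "\<dots> \<le> c + d"
        using sublinear_add[OF q, of "a + s *\<^sub>R y" "b + t *\<^sub>R y"] by (simp add: c d algebra_simps)
      finally show "r (a + b) \<le> c + d" .
    qed auto
  next
    fix s :: real and x assume s: "0 < s"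
    show "r (s *\<^sub>R x) \<le> s * r x"
      unfolding r_def
    proof (rule Inf_le_mult_Inf[OF _ bdd s])
      fix c assume "c \<in> (\<lambda>t. q (x + t *\<^sub>R y) - t * q y) ` {0..}"
      then obtain t where t: "0 \<le> t" "c = q (x + t *\<^sub>R y) - t * q y"
        by auto
      \<comment> \<open>Scaling the argument by \<open>s\<close> turns the parameter
        \<open>t\<close> into \<open>s * t\<close>.\<close>
      have "s * c = q (s *\<^sub>R x + (s * t) *\<^sub>R y) - (s * t) * q y"
        unfolding t(2) using sublinear_scale[OF q, of s "x + t *\<^sub>R y"] s
        by (simp add: algebra_simps)
      then show "s * c \<in> (\<lambda>t. q (s *\<^sub>R x + t *\<^sub>R y) - t * q y) ` {0..}"
        using s t(1) by (intro image_eqI[of _ _ "s * t"]) auto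
    qed auto
  qed
qed

text \<open>This is a form of the algebraic Hahn-Banach theorem. A minimal sublinear function below
  \<open>p\<close> is additive by \<open>sublinear_below_along\<close>, hence odd, and oddness
  extends positive homogeneity to all scalars.\<close>

lemma sublinear_dominates_linear:
  fixes p :: "'a::real_vector \<Rightarrow> real"
  assumes p: "sublinear p"
  obtains f where "linear f" "f \<le> p"
proof -
  define S where "S = {q. sublinear q \<and> q \<le> p}"
  \<comment> \<open>The order is reversed: maximal elements in Zorn's lemma are minimal functions,
    and upper bounds of chains are pointwise lower bounds.\<close>
  let ?R = "relation_of (\<lambda>q r. r \<le> q) S"
  have "partial_order_on S ?R"
    by (rule partial_order_on_relation_ofI) auto
  moreover have "\<exists>u\<in>S. \<forall>q\<in>C. u \<le> q" if C: "C \<in> Chains ?R" for C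
  proof (cases "C = {}")
    case True
    then show ?thesis
      using p by (auto simp: S_def)
  next
    case False
    have CS: "q \<in> S" if "q \<in> C" for q
      using C that by (auto simp: Chains_def relation_of_def)
    have chain: "q \<le> r \<or> r \<le> q" if "q \<in> C" "r \<in> C" for q r
      using C that by (auto simp: Chains_def relation_of_def)
    let ?u = "\<lambda>x. INF q\<in>C. q x"
    have u: "sublinear ?u" "\<And>q. q \<in> C \<Longrightarrow> ?u \<le> q"
      using sublinear_Inf_chain[OF False, of p] CS chain by (auto simp: S_def)
    obtain q where "q \<in> C"
      using False by auto
    then have "?u \<le> p"
      using u(2)[of q] CS[of q] by (auto simp: S_def intro: order_trans)
    then show ?thesis
      using u by (intro bexI[of _ ?u]) (auto simp: S_def)
  qed
  ultimately obtain f where f: "f \<in> S" and min: "\<And>q. q \<in> S \<Longrightarrow> q \<le> f \<Longrightarrow> q = f"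
    using predicate_Zorn[of S "\<lambda>q r. r \<le> q"] by blast
  have sub: "sublinear f" and le: "f \<le> p"
    using f by (auto simp: S_def)
  have add: "f (x + y) = f x + f y" for x y
  proof -
    obtain r where r: "sublinear r" "r \<le> f" "\<And>x. r x \<le> f (x + y) - f y"
      using sublinear_below_along[OF sub] by blast
    then have "r = f"
      using le by (intro min) (auto simp: S_def)
    then show ?thesis
      using r(3)[of x] sublinear_add[OF sub, of x y] by simp
  qed
  have minus: "f (- x) = - f x" for x
    using add[of x "- x"] sublinear_0[OF sub] by simp
  have "f (t *\<^sub>R x) = t * f x" for t x
    using sublinear_scale[OF sub, of t x] sublinear_scale[OF sub, of "- t" x] minus[of "t *\<^sub>R x"]
    by (cases "0 \<le> t") auto
  then have "linear f"
    using add by (intro linearI) auto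
  then show thesis
    using le that by blast
qed

section \<open>Separation\<close>

text \<open>The cone \<open>P\<close> generated by \<open>M\<close> defines an order with order unit
  \<open>e\<close>. A linear functional below the associated gauge is nonnegative on
  \<open>P\<close> and positive at \<open>e\<close>, so it can be normalised there.\<close>

lemma convex_algebraic_supporting_functional:
  fixes M :: "'a::real_vector set"
  assumes M: "convex M" "0 \<notin> M" "e \<in> M"
    and absorb: "\<And>v. \<exists>\<epsilon>>0. e + \<epsilon> *\<^sub>R v \<in> M"
  obtains f :: "'a \<Rightarrow> real" where "linear f" "f e = 1" "\<And>m. m \<in> M \<Longrightarrow> 0 \<le> f m"
proof -
  define P where "P = {s *\<^sub>R m |s m. 0 < s \<and> m \<in> M}"
  have P_M: "m \<in> P" if "m \<in> M" for m
    using that by (auto simp: P_def intro!: exI[of _ 1])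
  have P0: "0 \<notin> P"
    using M(2) by (auto simp: P_def)
  have P_scale: "t *\<^sub>R x \<in> P" if "0 < t" "x \<in> P" for t x
  proof -
    obtain s m where "0 < s" "m \<in> M" "x = s *\<^sub>R m"
      using \<open>x \<in> P\<close> by (auto simp: P_def)
    then show ?thesis
      using \<open>0 < t\<close> by (auto simp: P_def intro!: exI[of _ "t * s"] exI[of _ m])
  qed
  have P_add: "x + y \<in> P" if "x \<in> P" "y \<in> P" for x y
  proof -
    obtain s m t n where st: "0 < s" "0 < t" and mn: "m \<in> M" "n \<in> M"
      and xy: "x = s *\<^sub>R m" "y = t *\<^sub>R n"
      using \<open>x \<in> P\<close> \<open>y \<in> P\<close> by (auto simp: P_def)
    have "(s / (s + t)) *\<^sub>R m + (t / (s + t)) *\<^sub>R n \<in> M"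
      using st mn by (intro convexD[OF M(1)]) (auto simp: add_divide_distrib[symmetric])
    moreover have "x + y = (s + t) *\<^sub>R ((s / (s + t)) *\<^sub>R m + (t / (s + t)) *\<^sub>R n)"
      using st add_pos_pos[OF st] by (simp add: xy scaleR_add_right)
    ultimately show ?thesis
      using st by (auto simp: P_def intro!: exI[of _ "s + t"])
  qed
  \<comment> \<open>For negative \<open>t\<close>, both \<open>t *\<^sub>R e\<close> and its
    negative would lie in \<open>P\<close>, and so would their sum 0.\<close>
  have pos: "0 < t" if "t *\<^sub>R e \<in> P" for t
  proof (rule ccontr)
    assume "\<not> 0 < t"
    show False
    proof (cases "t = 0")
      case False
      with \<open>\<not> 0 < t\<close> have "t *\<^sub>R e + (- t) *\<^sub>R e \<in> P"
        using M(3) by (intro P_add that P_scale P_M) auto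
      then show False
        using P0 by simp
    qed (use that P0 in simp)
  qed
  \<comment> \<open>Absorption in the direction \<open>- x\<close> shows that some multiple of
    \<open>e\<close> dominates \<open>x\<close>.\<close>
  have unit: "\<exists>t. t *\<^sub>R e - x \<in> P" for x
  proof -
    obtain \<epsilon> where "0 < \<epsilon>" "e + \<epsilon> *\<^sub>R (- x) \<in> M"
      using absorb by blast
    then have "inverse \<epsilon> *\<^sub>R (e + \<epsilon> *\<^sub>R (- x)) \<in> P"
      by (intro P_scale P_M) auto
    then show ?thesis
      using \<open>0 < \<epsilon>\<close> by (auto simp: algebra_simps)
  qed
  \<comment> \<open>Reading \<open>u - v \<in> P\<close> as "u is above v", \<open>Inf (T x)\<close>
    is the infimum of the coefficients of the multiples of \<open>e\<close> above
    \<open>x\<close>.\<close>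
  define T where "T x = {t. t *\<^sub>R e - x \<in> P}" for x
  have T_ne: "T x \<noteq> {}" for x
    using unit by (auto simp: T_def)
  have bdd: "bdd_below (T x)" for x
  proof -
    obtain s where s: "s *\<^sub>R e - (- x) \<in> P"
      using unit by blast
    have "- s \<le> t" if "t \<in> T x" for t
    proof -
      have "(t *\<^sub>R e - x) + (s *\<^sub>R e - (- x)) \<in> P"
        using that s by (intro P_add) (auto simp: T_def)
      then have "0 < t + s"
        by (intro pos) (simp add: algebra_simps)
      then show ?thesis
        by simp
    qed
    then show ?thesis
      by (rule bdd_belowI)
  qed
  have "sublinear (\<lambda>x. Inf (T x))"
  proof (rule sublinearI)
    fix x y
    show "Inf (T (x + y)) \<le> Inf (T x) + Inf (T y)"
    proof (rule le_Inf_add_Inf[OF T_ne T_ne])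
      fix s t assume "s \<in> T x" "t \<in> T y"
      then have "(s *\<^sub>R e - x) + (t *\<^sub>R e - y) \<in> P"
        by (intro P_add) (auto simp: T_def)
      then have "s + t \<in> T (x + y)"
        by (simp add: T_def algebra_simps)
      then show "Inf (T (x + y)) \<le> s + t"
        using bdd by (intro cInf_lower)
    qed
  next
    fix t :: real and x assume t: "0 < t"
    show "Inf (T (t *\<^sub>R x)) \<le> t * Inf (T x)"
    proof (rule Inf_le_mult_Inf[OF T_ne bdd t])
      fix s assume "s \<in> T x"
      then have "t *\<^sub>R (s *\<^sub>R e - x) \<in> P"
        using t by (intro P_scale) (auto simp: T_def)
      then show "t * s \<in> T (t *\<^sub>R x)"
        by (simp add: T_def algebra_simps)
    qed
  qed
  then obtain f where f: "linear f" "f \<le> (\<lambda>x. Inf (T x))"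
    using sublinear_dominates_linear by blast
  \<comment> \<open>For \<open>x \<in> P\<close> the number 0 belongs to
    \<open>T (- x)\<close>.\<close>
  have nonneg: "0 \<le> f x" if "x \<in> P" for x
  proof -
    have "f (- x) \<le> Inf (T (- x))"
      using f(2) by (rule le_funD)
    also have "\<dots> \<le> 0"
      using that by (intro cInf_lower bdd) (simp add: T_def)
    finally show ?thesis
      by (simp add: linear_neg[OF f(1)])
  qed
  \<comment> \<open>The value -1 itself would require \<open>0 \<in> P\<close>, so it is approached
    through \<open>- 1 + t\<close>, which belongs to \<open>T (- e)\<close> because
    \<open>t *\<^sub>R e \<in> P\<close>.\<close>
  have "f (- e) \<le> - 1"
  proof -
    have "Inf (T (- e)) \<le> - 1 + t" if "0 < t" for t
      using P_scale[OF that P_M[OF M(3)]]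
      by (intro cInf_lower bdd) (simp add: T_def algebra_simps)
    then have "Inf (T (- e)) \<le> - 1"
      by (rule field_le_epsilon)
    then show ?thesis
      using le_funD[OF f(2), of "- e"] by simp
  qed
  then have fe: "1 \<le> f e"
    by (simp add: linear_neg[OF f(1)])
  define g where "g x = f x / f e" for x
  show thesis
  proof
    show "linear g"
      unfolding g_def using f(1)
      by (intro linearI) (auto simp: linear_add linear_scale add_divide_distrib)
    show "g e = 1"
      using fe by (simp add: g_def)
    show "0 \<le> g m" if "m \<in> M" for m
      using nonneg[OF P_M[OF that]] fe by (simp add: g_def)
  qed
qed

section \<open>Absorption, continuity and separation in topological vector spaces\<close>

lemma tendsto_scaleR_tvs [tendsto_intros]:
  fixes g :: "'b \<Rightarrow> 'a::topological_real_vector"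
  assumes "(f \<longlongrightarrow> c) F" "(g \<longlongrightarrow> x) F"
  shows "((\<lambda>z. f z *\<^sub>R g z) \<longlongrightarrow> c *\<^sub>R x) F"
  using filterlim_compose[OF tendsto_scaleR_Pair filterlim_Pair[OF assms]] by simp

lemma open_absorbing:
  fixes C :: "'a::topological_real_vector set"
  assumes "open C" "c \<in> C"
  shows "\<exists>\<epsilon>>0. c + \<epsilon> *\<^sub>R v \<in> C"
proof -
  have "((\<lambda>t. c + t *\<^sub>R v) \<longlongrightarrow> c + 0 *\<^sub>R v) (at_right 0)"
    by (intro tendsto_intros)
  then have "\<forall>\<^sub>F t in at_right 0. c + t *\<^sub>R v \<in> C"
    using assms by (auto dest: topological_tendstoD)
  then have "\<forall>\<^sub>F t in at_right (0::real). 0 < t \<and> c + t *\<^sub>R v \<in> C"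
    using eventually_at_right_less[of "0::real"] by eventually_elim auto
  then show ?thesis
    using eventually_happens[of _ "at_right (0::real)"] by auto
qed

text \<open>A small displacement \<open>z - x\<close>, scaled by \<open>B / \<epsilon>\<close>, can
  be both added to and subtracted from \<open>c\<close> without leaving \<open>C\<close>. The upper
  bound thus controls \<open>f z - f x\<close> in both signs.\<close>

lemma linear_bounded_above_on_open_imp_continuous:
  fixes f :: "'a::topological_real_vector \<Rightarrow> real"
  assumes f: "linear f" and C: "open C" "c \<in> C" and le: "\<And>x. x \<in> C \<Longrightarrow> f x \<le> b"
  shows "continuous_on UNIV f"
  unfolding continuous_on_def
proof (intro ballI tendstoI)
  fix x and \<epsilon> :: real assume "0 < \<epsilon>"
  \<comment> \<open>The added 1 makes \<open>B\<close> positive and the final estimate strict even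
    if \<open>b = f c\<close>.\<close>
  define B where "B = b - f c + 1"
  have B: "0 < B"
    using le[OF C(2)] by (simp add: B_def)
  have "((\<lambda>z. c + (B / \<epsilon>) *\<^sub>R (z - x)) \<longlongrightarrow> c + (B / \<epsilon>) *\<^sub>R (x - x)) (at x)"
    and "((\<lambda>z. c - (B / \<epsilon>) *\<^sub>R (z - x)) \<longlongrightarrow> c - (B / \<epsilon>) *\<^sub>R (x - x)) (at x)"
    by (intro tendsto_intros)+
  then have "\<forall>\<^sub>F z in at x. c + (B / \<epsilon>) *\<^sub>R (z - x) \<in> C"
    and "\<forall>\<^sub>F z in at x. c - (B / \<epsilon>) *\<^sub>R (z - x) \<in> C"
    using C by (auto dest: topological_tendstoD)
  then show "\<forall>\<^sub>F z in at x. dist (f z) (f x) < \<epsilon>"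
  proof eventually_elim
    case (elim z)
    have "f c + (B / \<epsilon>) * (f z - f x) \<le> b" "f c - (B / \<epsilon>) * (f z - f x) \<le> b"
      using le[OF elim(1)] le[OF elim(2)]
      by (simp_all add: linear_add[OF f] linear_diff[OF f] linear_scale[OF f])
    then have "\<bar>(B / \<epsilon>) * (f z - f x)\<bar> < B"
      unfolding B_def by linarith
    then have "(B / \<epsilon>) * \<bar>f z - f x\<bar> < B"
      using B \<open>0 < \<epsilon>\<close> by (simp add: abs_mult)
    then show ?case
      using B \<open>0 < \<epsilon>\<close> by (simp add: dist_real_def field_simps)
  qed
qed

text \<open>Disjointness keeps 0 out of the difference set \<open>M\<close>, and openness of
  \<open>C\<close> makes \<open>M\<close> absorbing at \<open>d0 - c0\<close>. The threshold is the
  supremum of \<open>f\<close> over \<open>C\<close>. It is not attained, since from any point of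
  \<open>C\<close> one can move a little along \<open>d0 - c0\<close>, where \<open>f\<close>
  increases.\<close>

lemma separate_open_convex:
  fixes C D :: "'a::topological_real_vector set"
  assumes C: "open C" "convex C" "C \<noteq> {}" and D: "convex D" "D \<noteq> {}" and "D \<inter> C = {}"
  obtains f :: "'a \<Rightarrow> real" and \<beta> where "linear f" "continuous_on UNIV f"
    "\<And>c. c \<in> C \<Longrightarrow> f c < \<beta>" "\<And>d. d \<in> D \<Longrightarrow> \<beta> \<le> f d"
proof -
  obtain c0 d0 where c0: "c0 \<in> C" and d0: "d0 \<in> D"
    using C(3) D(2) by blast
  define M where "M = (\<Union>d\<in>D. \<Union>c\<in>C. {d - c})"
  have "convex M"
    unfolding M_def by (rule convex_differences[OF D(1) C(2)])
  moreover have "0 \<notin> M"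
    using \<open>D \<inter> C = {}\<close> by (auto simp: M_def)
  moreover have "d0 - c0 \<in> M"
    using c0 d0 by (auto simp: M_def)
  moreover have "\<exists>\<epsilon>>0. d0 - c0 + \<epsilon> *\<^sub>R v \<in> M" for v
  proof -
    obtain \<epsilon> where "0 < \<epsilon>" "c0 + \<epsilon> *\<^sub>R (- v) \<in> C"
      using open_absorbing[OF C(1) c0] by blast
    then have "d0 - (c0 + \<epsilon> *\<^sub>R (- v)) \<in> M"
      using d0 by (auto simp: M_def)
    then show ?thesis
      using \<open>0 < \<epsilon>\<close> by (auto simp: algebra_simps)
  qed
  ultimately obtain f :: "'a \<Rightarrow> real"
    where f: "linear f" "f (d0 - c0) = 1" "\<And>m. m \<in> M \<Longrightarrow> 0 \<le> f m"
    using convex_algebraic_supporting_functional by blast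
  have le: "f c \<le> f d" if "c \<in> C" "d \<in> D" for c d
  proof -
    have "0 \<le> f (d - c)"
      using that by (intro f(3)) (auto simp: M_def)
    then show ?thesis
      by (simp add: linear_diff[OF f(1)])
  qed
  have bdd: "bdd_above (f ` C)"
    using le[OF _ d0] by (rule bdd_aboveI2)
  show thesis
  proof
    show "linear f" by (fact f(1))
    show "continuous_on UNIV f"
      using linear_bounded_above_on_open_imp_continuous[OF f(1) C(1) c0 le[OF _ d0]] .
    show "f c < (SUP c\<in>C. f c)" if c: "c \<in> C" for c
    proof -
      obtain \<epsilon> where "0 < \<epsilon>" and mem: "c + \<epsilon> *\<^sub>R (d0 - c0) \<in> C"
        using open_absorbing[OF C(1) c] by blast
      then have "f c < f c + \<epsilon> * f (d0 - c0)"
        using f(2) by simp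
      also have "\<dots> = f (c + \<epsilon> *\<^sub>R (d0 - c0))"
        by (simp add: linear_add[OF f(1)] linear_scale[OF f(1)])
      also have "\<dots> \<le> (SUP c\<in>C. f c)"
        using mem bdd by (rule cSUP_upper)
      finally show ?thesis .
    qed
    show "(SUP c\<in>C. f c) \<le> f d" if "d \<in> D" for d
      using le that C(3) by (intro cSUP_least) auto
  qed
qed

section \<open>Interiors of convex sets\<close>

lemma convex_combination_in_interior:
  fixes S :: "'a::topological_real_vector set"
  assumes S: "convex S" "s \<in> S" "c \<in> interior S" and t: "0 < t" "t \<le> 1"
  shows "(1 - t) *\<^sub>R s + t *\<^sub>R c \<in> interior S"
proof -
  \<comment> \<open>This inverts the map taking \<open>z\<close> to
    \<open>(1 - t) *\<^sub>R s + t *\<^sub>R z\<close>. The preimage of the interior is therefore an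
    open neighbourhood of the given point, and convexity puts it inside \<open>S\<close>.\<close>
  let ?h = "\<lambda>z. inverse t *\<^sub>R (z - (1 - t) *\<^sub>R s)"
  have "continuous_on UNIV ?h"
    unfolding continuous_on_def by (intro ballI tendsto_intros)
  then have "open (?h -` interior S)"
    by (intro open_vimage) auto
  moreover have "(1 - t) *\<^sub>R s + t *\<^sub>R c \<in> ?h -` interior S"
    using S(3) t by simp
  moreover have "?h -` interior S \<subseteq> S"
  proof
    fix z assume "z \<in> ?h -` interior S"
    then have "?h z \<in> S"
      using interior_subset by auto
    then have "(1 - t) *\<^sub>R s + t *\<^sub>R ?h z \<in> S"
      using t S(2) by (intro convexD[OF S(1)]) auto
    then show "z \<in> S"
      using t by simp
  qed
  ultimately show ?thesis
    by (rule interiorI)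
qed

lemma convex_interior_tvs:
  fixes S :: "'a::topological_real_vector set"
  assumes "convex S"
  shows "convex (interior S)"
proof (rule convexI)
  fix x y and u v :: real
  assume xy: "x \<in> interior S" "y \<in> interior S" and uv: "0 \<le> u" "0 \<le> v" "u + v = 1"
  show "u *\<^sub>R x + v *\<^sub>R y \<in> interior S"
  proof (cases "v = 0")
    case False
    have u: "u = 1 - v"
      using uv by simp
    show ?thesis
      unfolding u using xy(1) uv False interior_subset
      by (intro convex_combination_in_interior[OF assms _ xy(2)]) auto
  qed (use xy uv in simp)
qed

text \<open>Points of the segment from \<open>s\<close> to an interior point, other than
  \<open>s\<close>, are interior; the bound passes to the limit at \<open>s\<close>.\<close>

lemma linear_le_from_interior:
  fixes f :: "'a::topological_real_vector \<Rightarrow> real"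
  assumes f: "linear f" and S: "convex S" "interior S \<noteq> {}" "s \<in> S"
    and le: "\<And>c. c \<in> interior S \<Longrightarrow> f c \<le> b"
  shows "f s \<le> b"
proof -
  obtain c where c: "c \<in> interior S"
    using S(2) by blast
  have "((\<lambda>t. (1 - t) * f s + t * f c) \<longlongrightarrow> (1 - 0) * f s + 0 * f c) (at_right 0)"
    by (intro tendsto_intros)
  moreover have "\<forall>\<^sub>F t in at_right (0::real). (1 - t) * f s + t * f c \<le> b"
    using eventually_at_right_real[of 0 "1::real"]
  proof (rule eventually_mono)
    fix t :: real assume "t \<in> {0<..<1}"
    then have "f ((1 - t) *\<^sub>R s + t *\<^sub>R c) \<le> b"
      by (intro le convex_combination_in_interior S c) auto
    then show "(1 - t) * f s + t * f c \<le> b"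
      by (simp add: linear_add[OF f] linear_scale[OF f])
  qed simp
  ultimately show ?thesis
    using tendsto_upperbound[of _ "f s" "at_right (0::real)"] by simp
qed

section \<open>Cones and normlike-bases\<close>

lemma is_cone_scale: "is_cone K \<Longrightarrow> x \<in> K \<Longrightarrow> 0 \<le> t \<Longrightarrow> t *\<^sub>R x \<in> K"
  unfolding is_cone_def by blast

lemma normlike_base_decompose:
  assumes "is_seminorm \<psi>" "is_cone K" "has_normlike_base \<psi> K" "x \<in> K" "x \<noteq> 0"
  obtains b where "b \<in> normlike_base \<psi> K" "x = \<psi> x *\<^sub>R b" "0 < \<psi> x"
proof
  show pos: "0 < \<psi> x"
    using assms by (auto simp: has_normlike_base_def)
  show "inverse (\<psi> x) *\<^sub>R x \<in> normlike_base \<psi> K"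
    using assms pos by (auto simp: normlike_base_def is_cone_scale is_seminorm_def)
  show "x = \<psi> x *\<^sub>R inverse (\<psi> x) *\<^sub>R x"
    using pos by simp
qed

theorem theorem5p4:
  fixes \<psi> :: "'a::topological_real_vector \<Rightarrow> real" and K A :: "'a set"
  assumes "is_seminorm \<psi>"
    and "nontrivial_cone K" and "nontrivial_cone A"
    and "has_normlike_base \<psi> K" and "has_normlike_base \<psi> A"
    and "solid K"
    and "solid (S_neg \<psi> K)"
    and "S_zero \<psi> A \<inter> interior (S_neg \<psi> K) = {}"
  shows "(\<exists>(x', \<alpha>) \<in> top_aug_dual_cone \<psi> K.
           (\<forall>a \<in> A. \<forall>k \<in> uminus ` K.
              x' a + \<alpha> * \<psi> a \<ge> 0 \<and> 0 \<ge> x' k + \<alpha> * \<psi> k) \<and>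
           (\<forall>a \<in> A. \<forall>k \<in> interior (uminus ` K).
              x' a + \<alpha> * \<psi> a \<ge> 0 \<and> 0 > x' k + \<alpha> * \<psi> k)) \<and>
         A \<inter> interior (uminus ` K) = {} \<and>
         0 \<notin> interior (S_neg \<psi> K)"
proof -
  have cones: "is_cone K" "is_cone A"
    using assms(2,3) by (auto simp: nontrivial_cone_def)
  have sub: "sublinear \<psi>" and sym: "\<psi> (- x) = \<psi> x" for x
    using assms(1) by (auto simp: is_seminorm_def sublinear_def)
  have convex_S: "convex (S_neg \<psi> K)" and convex_S0: "convex (S_zero \<psi> A)"
    by (simp_all add: S_neg_def S_zero_def)
  have S_ne: "interior (S_neg \<psi> K) \<noteq> {}"
    using assms(7) by (simp add: solid_def)
  have S0_0: "0 \<in> S_zero \<psi> A"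
    by (simp add: S_zero_def hull_inc)
  then have not_0: "0 \<notin> interior (S_neg \<psi> K)"
    using assms(8) by blast
  obtain x' :: "'a \<Rightarrow> real" and \<beta> where lin: "linear x'" and cont: "continuous_on UNIV x'"
    and below: "\<And>c. c \<in> interior (S_neg \<psi> K) \<Longrightarrow> x' c < \<beta>"
    and above: "\<And>d. d \<in> S_zero \<psi> A \<Longrightarrow> \<beta> \<le> x' d"
    using separate_open_convex[OF open_interior convex_interior_tvs[OF convex_S] S_ne convex_S0]
      S0_0 assms(8) by blast
  \<comment> \<open>With this sign, \<open>x' + \<alpha> * \<psi>\<close> equals
    \<open>x' - \<beta>\<close> wherever \<open>\<psi>\<close> is 1, in particular on
    \<open>B_A\<close> and on \<open>- B_K\<close>.\<close>
  define \<alpha> where "\<alpha> = - \<beta>"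
  have \<alpha>: "0 \<le> \<alpha>"
    using above[OF S0_0] by (simp add: \<alpha>_def linear_0[OF lin])
  define f where "f x = x' x + \<alpha> * \<psi> x" for x
  have f_add: "f (x + y) \<le> f x + f y" for x y
    using mult_left_mono[OF sublinear_add[OF sub, of x y] \<alpha>]
    by (simp add: f_def linear_add[OF lin] algebra_simps)
  have f_scale: "f (t *\<^sub>R x) = t * f x" if "0 \<le> t" for t x
    using that by (simp add: f_def linear_scale[OF lin] sublinear_scale[OF sub] algebra_simps)
  have f_0: "f 0 = 0"
    using f_scale[of 0 0] by simp
  have f_A: "0 \<le> f a" if "a \<in> A" for a
  proof (cases "a = 0")
    case False
    then obtain b where b: "b \<in> normlike_base \<psi> A" "a = \<psi> a *\<^sub>R b" "0 < \<psi> a"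
      using normlike_base_decompose[OF assms(1) cones(2) assms(5) \<open>a \<in> A\<close>] by blast
    then have "\<beta> \<le> x' b"
      by (intro above) (simp add: S_zero_def hull_inc)
    then have "0 \<le> f b"
      using b(1) by (simp add: f_def \<alpha>_def normlike_base_def)
    then have "0 \<le> \<psi> a * f b"
      using b(3) by simp
    then show ?thesis
      using f_scale[of "\<psi> a" b] b by simp
  qed (simp add: f_0)
  have f_K: "f (- k) \<le> 0" if "k \<in> K" for k
  proof (cases "k = 0")
    case False
    then obtain b where b: "b \<in> normlike_base \<psi> K" "k = \<psi> k *\<^sub>R b" "0 < \<psi> k"
      using normlike_base_decompose[OF assms(1) cones(1) assms(4) \<open>k \<in> K\<close>] by blast
    then have "- b \<in> S_neg \<psi> K"
      by (simp add: S_neg_def hull_inc)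
    \<comment> \<open>Negated base points need not be interior, so the strict separation only yields
      a weak bound here.\<close>
    then have "x' (- b) \<le> \<beta>"
      by (rule linear_le_from_interior[OF lin convex_S S_ne _ less_imp_le[OF below]])
    then have "f (- b) \<le> 0"
      using b(1) by (simp add: f_def \<alpha>_def normlike_base_def sym)
    then have "\<psi> k * f (- b) \<le> 0"
      using b(3) by (simp add: mult_nonneg_nonpos)
    moreover have "- k = \<psi> k *\<^sub>R (- b)"
      using b(2) by simp
    ultimately show ?thesis
      using f_scale[of "\<psi> k" "- b"] b(3) by simp
  qed (simp add: f_0)
  obtain c where c: "c \<in> interior (S_neg \<psi> K)"
    using S_ne by blast
  then have c_S: "c \<in> S_neg \<psi> K"
    using interior_subset by blast
  have f_c: "f c < 0"
  proof -
    \<comment> \<open>Convex combinations of points with \<open>\<psi>\<close> equal to 1 may have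
      smaller \<open>\<psi>\<close>, but not larger. As \<open>\<alpha>\<close> is nonnegative, this
      bounds \<open>f c\<close> by \<open>x' c - \<beta>\<close>, which is negative.\<close>
    have "convex {x. \<psi> x \<le> 1}"
    proof (rule convexI, clarify)
      fix x y and u v :: real
      assume xy: "\<psi> x \<le> 1" "\<psi> y \<le> 1" and uv: "0 \<le> u" "0 \<le> v" "u + v = 1"
      have "\<psi> (u *\<^sub>R x + v *\<^sub>R y) \<le> u * \<psi> x + v * \<psi> y"
        using sublinear_add[OF sub, of "u *\<^sub>R x" "v *\<^sub>R y"] uv
        by (simp add: sublinear_scale[OF sub])
      also have "\<dots> \<le> 1"
        using xy uv by (rule convex_bound_le)
      finally show "\<psi> (u *\<^sub>R x + v *\<^sub>R y) \<le> 1" .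
    qed
    then have "S_neg \<psi> K \<subseteq> {x. \<psi> x \<le> 1}"
      unfolding S_neg_def by (intro hull_minimal) (auto simp: normlike_base_def sym)
    then have "\<alpha> * \<psi> c \<le> \<alpha>"
      using c_S \<alpha> by (auto intro: mult_left_le)
    then show ?thesis
      using below[OF c] by (simp add: f_def \<alpha>_def)
  qed
  \<comment> \<open>The hypothesis says that \<open>y - t *\<^sub>R c\<close> lies in
    \<open>- K\<close>. It holds for some \<open>t\<close> both at interior points of
    \<open>- K\<close> and at negatives of points of \<open>icor K\<close>.\<close>
  have strict: "f y < 0" if "0 < t" "- y + t *\<^sub>R c \<in> K" for y t
  proof -
    have "f (y - t *\<^sub>R c) \<le> 0"
      using f_K[OF that(2)] by (simp add: algebra_simps)
    moreover have "f y \<le> f (y - t *\<^sub>R c) + t * f c"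
      using f_add[of "y - t *\<^sub>R c" "t *\<^sub>R c"] f_scale[of t c] that(1) by simp
    moreover have "t * f c < 0"
      using that(1) f_c by (rule mult_pos_neg)
    ultimately show ?thesis
      by simp
  qed
  have f_int: "f k < 0" if k: "k \<in> interior (uminus ` K)" for k
  proof -
    obtain \<epsilon> where "0 < \<epsilon>" and "k + \<epsilon> *\<^sub>R (- c) \<in> interior (uminus ` K)"
      using open_absorbing[OF open_interior k] by blast
    then have "k + \<epsilon> *\<^sub>R (- c) \<in> uminus ` K"
      using interior_subset by blast
    then have "- k + \<epsilon> *\<^sub>R c \<in> K"
      by (elim imageE) (metis add.inverse_inverse minus_add_distrib scaleR_minus_right)
    then show ?thesis
      using strict \<open>0 < \<epsilon>\<close> by blast
  qed
  have f_icor: "0 < x' y - \<alpha> * \<psi> y" if y: "y \<in> icor K" for y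
  proof -
    \<comment> \<open>To apply the definition of \<open>icor\<close> in direction \<open>c\<close>,
      this direction must lie in the affine hull of \<open>K - K\<close>. It does, since
      \<open>- b = 0 - b\<close> for base points and convex hulls lie in affine hulls.\<close>
    let ?D = "{s - s' |s s'. s \<in> K \<and> s' \<in> K}"
    have "uminus ` normlike_base \<psi> K \<subseteq> ?D"
    proof clarify
      fix b assume "b \<in> normlike_base \<psi> K"
      then have "- b = 0 - b \<and> 0 \<in> K \<and> b \<in> K"
        using cones(1) by (auto simp: normlike_base_def is_cone_def)
      then show "\<exists>s s'. - b = s - s' \<and> s \<in> K \<and> s' \<in> K"
        by blast
    qed
    then have "S_neg \<psi> K \<subseteq> affine hull ?D"
      unfolding S_neg_def using hull_mono convex_hull_subset_affine_hull by blast
    then obtain \<epsilon> where "0 < \<epsilon>" and "\<forall>t\<in>{0..\<epsilon>}. y + t *\<^sub>R c \<in> K"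
      using y c_S unfolding icor_def by blast
    then have "f (- y) < 0"
      by (intro strict[of \<epsilon>]) auto
    then show ?thesis
      by (simp add: f_def sym linear_neg[OF lin])
  qed
  \<comment> \<open>The sign of \<open>f\<close> at \<open>- k\<close> reads
    \<open>\<alpha> * \<psi> k \<le> x' k\<close>, and the left side is nonnegative.\<close>
  have x'_K: "0 \<le> x' k" if "k \<in> K" for k
  proof -
    have "0 \<le> \<psi> k"
      using sublinear_minus[OF sub, of k] sym[of k] by simp
    then have "0 \<le> \<alpha> * \<psi> k"
      using \<alpha> by simp
    then show ?thesis
      using f_K[OF that] by (simp add: f_def sym linear_neg[OF lin])
  qed
  have "x' \<in> dual_cone K"
    using x'_K lin by (auto simp: dual_cone_def algebraic_dual_def)
  \<comment> \<open>Otherwise \<open>x'\<close> would be nonpositive on \<open>K\<close>, hence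
    nonnegative on the convex hull of \<open>- B_K\<close>, whereas
    \<open>x' c < \<beta> \<le> 0\<close>.\<close>
  moreover have "x' \<notin> lineality (dual_cone K)"
  proof
    assume "x' \<in> lineality (dual_cone K)"
    then obtain y' where "x' = - y'" "y' \<in> dual_cone K"
      by (auto simp: lineality_def)
    then have "x' k \<le> 0" if "k \<in> K" for k
      using that by (auto simp: dual_cone_def)
    then have "uminus ` normlike_base \<psi> K \<subseteq> x' -` {0..}"
      by (auto simp: normlike_base_def linear_neg[OF lin])
    then have "S_neg \<psi> K \<subseteq> x' -` {0..}"
      unfolding S_neg_def by (intro hull_minimal convex_linear_vimage lin) auto
    then have "0 \<le> x' c"
      using c_S by auto
    then show False
      using below[OF c] \<alpha> by (simp add: \<alpha>_def)
  qed
  ultimately have mem: "(x', \<alpha>) \<in> top_aug_dual_cone \<psi> K"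
    using f_icor \<alpha> lin cont
    by (auto simp: top_aug_dual_cone_def aug_dual_cone_def topological_dual_def)
  have "A \<inter> interior (uminus ` K) = {}"
    using f_A f_int by force
  with mem not_0 show ?thesis
    using f_A f_K f_int by (intro conjI bexI[of _ "(x', \<alpha>)"]) (auto simp: f_def)
qed

end
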